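(* Let $k\geq 3$. A locally finite poset $P$ is $d_{\leq k}$-complete if and only if it satisfies any one of the following four combinations of axioms for all $3\leq h\leq k$ (that is, each of the four combinations, imposed for all $3\le h\le k$, is equivalent to $P$ being $d_{\leq k}$-complete): (a) (D$h^-$C), (D$h$MF), and (NOD$h^-$); (b) (D$h^-$C), (D$h$MF), and (D$h$MD); (c) (D$h^-$CF) and (NOD$h^-$); (d) (D$h^-$CF) and (D$h$MD). Hence $P$ is $d$-complete if and only if it satisfies any one of these combinations of axioms for all $h\geq 3$.
   Context: All posets are locally finite (every closed interval is finite). Write $x\rightarrow y$ when $y$ covers $x$; $\{x,y\}\rightarrow z$ means $x\to z$ and $y\to z$; $w\to\{x,y\}$ means $w\to x$ and $w\to y$. For $k\ge 3$ the double tailed diamond poset $d_k(1)$ is the $(2k-2)$-element poset $\{a_k,\dots,a_3;b,c;f_3,\dots,f_k\}$ with covering relations $a_k\to a_{k-1}\to\cdots\to a_3\to\{b,c\}\to f_3\to f_4\to\cdots\to f_k$ (so $b,c$ are its only incomparable pair). An interval $[w,z]$ is a $d_k$-interval if it is isomorphic to $d_k(1)$. A convex subset is a $d_k^-$-set if it is isomorphic to $d_k(1)-\{f_k\}$; for $k=3$ this is a set $\{w;x,y\}$ of distinct elements with $w\to\{x,y\}$. For $k\ge 4$ a $d_k^-$-set is an interval and is also called a $d_k^-$-interval. Two $d_3^-$-sets $\{w;x,y\}$ and $\{w';x,y\}$ with $w\neq w'$ are said to overlap. For $k\geq 4$, if $[w,z']$ is a $d_k^-$-interval in which $u$ is the unique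 element covering $w$, and $w'\ne w$ is also covered by $u$ and $[w',z']$ is also a $d_k^-$-interval, then $[w,z']$ and $[w',z']$ overlap. Two $d_k$-intervals are distinct if they differ as sets. Definition of completeness: a poset is $d_k$-complete if for every $d_k^-$-set $S$ there exists an element that covers exactly the maximal element(s) of $S$ and that does not cover the maximal element (when $k=3$: both of the maximal elements) of any other $d_k^-$-set. It is $d_{\leq k}$-complete if it is $d_h$-complete for every $3\le h\le k$, and $d$-complete if it is $d_k$-complete for every $k\ge 3$. Axioms, for $h\ge 3$: (D$h^-$C) for each $d_h^-$-set $S$ there exists $z$ such that $S\cup\{z\}$ is a $d_h$-interval. (D$h$MF) the maximum element of each $d_h$-interval covers only elements in that interval. (D$h^-$CF) for each $d_h^-$-set $S$ there exists $z$ such that $S\cup\{z\}$ is a $d_h$-interval with maximum element $z$ and $z$ covers only elements of $S$. (NOD$h^-$) there do not exist overlapping $d_h^-$-sets. (D$h$MD) the maximum elements of distinct $d_h$-intervals are distinct. *)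

theory Defs
  imports Main
begin

text \<open>
  A poset is a set \<open>P\<close> over an arbitrary order type, carrying the induced order; it may be empty.
  Coverings, intervals and convexity are all relative to \<open>P\<close>.
\<close>

definition locally_finite :: "'a::order set \<Rightarrow> bool" where
  "locally_finite P \<longleftrightarrow> (\<forall>x\<in>P. \<forall>y\<in>P. finite ({x..y} \<inter> P))"

text \<open>\<open>covered_by P x y\<close> is \<open>x \<rightarrow> y\<close>, i.e. \<open>y\<close> covers \<open>x\<close> in \<open>P\<close>.\<close>

definition covered_by :: "'a::order set \<Rightarrow> 'a \<Rightarrow> 'a \<Rightarrow> bool" where
  "covered_by P x y \<longleftrightarrow> x \<in> P \<and> y \<in> P \<and> x < y \<and> \<not> (\<exists>z\<in>P. x < z \<and> z < y)"

definition convex_in :: "'a::order set \<Rightarrow> 'a set \<Rightarrow> bool" where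
  "convex_in P S \<longleftrightarrow> S \<subseteq> P \<and> (\<forall>x\<in>S. \<forall>y\<in>S. {x..y} \<inter> P \<subseteq> S)"

definition maximal_elements :: "'a::order set \<Rightarrow> 'a set" where
  "maximal_elements S = {x \<in> S. \<not> (\<exists>y\<in>S. x < y)}"

definition is_maximum :: "'a::order set \<Rightarrow> 'a \<Rightarrow> bool" where
  "is_maximum S m \<longleftrightarrow> m \<in> S \<and> (\<forall>x\<in>S. x \<le> m)"

text \<open>\<open>DA i\<close>, \<open>DB\<close>, \<open>DC\<close>, \<open>DF i\<close> are \<open>a\<^sub>i\<close>, \<open>b\<close>, \<open>c\<close>, \<open>f\<^sub>i\<close>; only the indices \<open>3 \<le> i \<le> k\<close> occur in \<open>d\<^sub>k(1)\<close>.\<close>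

datatype ddiamond = DA nat | DB | DC | DF nat

definition ddiamond_carrier :: "nat \<Rightarrow> ddiamond set" where
  "ddiamond_carrier k = DA ` {3..k} \<union> {DB, DC} \<union> DF ` {3..k}"

inductive ddiamond_step :: "nat \<Rightarrow> ddiamond \<Rightarrow> ddiamond \<Rightarrow> bool" for k :: nat where
  "3 \<le> i \<Longrightarrow> i < k \<Longrightarrow> ddiamond_step k (DA (Suc i)) (DA i)"
| "ddiamond_step k (DA 3) DB"
| "ddiamond_step k (DA 3) DC"
| "ddiamond_step k DB (DF 3)"
| "ddiamond_step k DC (DF 3)"
| "3 \<le> i \<Longrightarrow> i < k \<Longrightarrow> ddiamond_step k (DF i) (DF (Suc i))"

definition ddiamond_le :: "nat \<Rightarrow> ddiamond \<Rightarrow> ddiamond \<Rightarrow> bool" where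
  "ddiamond_le k = (ddiamond_step k)\<^sup>*\<^sup>*"

definition order_isomorphic :: "'a::order set \<Rightarrow> 'b set \<Rightarrow> ('b \<Rightarrow> 'b \<Rightarrow> bool) \<Rightarrow> bool" where
  "order_isomorphic S T le \<longleftrightarrow>
     (\<exists>f. bij_betw f S T \<and> (\<forall>x\<in>S. \<forall>y\<in>S. x \<le> y \<longleftrightarrow> le (f x) (f y)))"

definition d_interval :: "'a::order set \<Rightarrow> nat \<Rightarrow> 'a set \<Rightarrow> bool" where
  "d_interval P k I \<longleftrightarrow>
     (\<exists>w\<in>P. \<exists>z\<in>P. I = {w..z} \<inter> P) \<and>
     order_isomorphic I (ddiamond_carrier k) (ddiamond_le k)"

definition d_minus_set :: "'a::order set \<Rightarrow> nat \<Rightarrow> 'a set \<Rightarrow> bool" where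
  "d_minus_set P k S \<longleftrightarrow>
     convex_in P S \<and>
     order_isomorphic S (ddiamond_carrier k - {DF k}) (ddiamond_le k)"

text \<open>
  For \<open>k = 3\<close> the shared elements \<open>x\<close>, \<open>y\<close> have to be the two maximal ones, which the
  covering conditions enforce.
\<close>

definition overlapping :: "'a::order set \<Rightarrow> nat \<Rightarrow> 'a set \<Rightarrow> 'a set \<Rightarrow> bool" where
  "overlapping P k S S' \<longleftrightarrow>
     d_minus_set P k S \<and> d_minus_set P k S' \<and>
     (if k = 3 then
        (\<exists>w w' x y. w \<noteq> w' \<and> S = {w, x, y} \<and> S' = {w', x, y} \<and>
           covered_by P w x \<and> covered_by P w y \<and> covered_by P w' x \<and> covered_by P w' y)
      else
        (\<exists>w\<in>P. \<exists>w'\<in>P. \<exists>z'\<in>P. \<exists>u. w \<noteq> w' \<and>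
           S = {w..z'} \<inter> P \<and> S' = {w'..z'} \<inter> P \<and>
           {v \<in> S. covered_by P w v} = {u} \<and> covered_by P w' u))"

text \<open>
  A \<open>d\<^sub>k\<^sup>-\<close>-set has two maximal elements if \<open>k = 3\<close> and exactly one if \<open>k > 3\<close>, so failing to
  cover both, respectively the one, is failing to cover all of them.
\<close>

definition dk_complete :: "'a::order set \<Rightarrow> nat \<Rightarrow> bool" where
  "dk_complete P k \<longleftrightarrow>
     (\<forall>S. d_minus_set P k S \<longrightarrow>
        (\<exists>z\<in>P. {x. covered_by P x z} = maximal_elements S \<and>
           (\<forall>S'. d_minus_set P k S' \<and> S' \<noteq> S \<longrightarrow>
              \<not> (\<forall>x\<in>maximal_elements S'. covered_by P x z))))"

definition d_upto_complete :: "'a::order set \<Rightarrow> nat \<Rightarrow> bool" where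
  "d_upto_complete P k \<longleftrightarrow> (\<forall>h. 3 \<le> h \<and> h \<le> k \<longrightarrow> dk_complete P h)"

definition d_complete :: "'a::order set \<Rightarrow> bool" where
  "d_complete P \<longleftrightarrow> (\<forall>k\<ge>3. dk_complete P k)"

definition axiom_DmC :: "'a::order set \<Rightarrow> nat \<Rightarrow> bool" where
  "axiom_DmC P h \<longleftrightarrow> (\<forall>S. d_minus_set P h S \<longrightarrow> (\<exists>z. d_interval P h (S \<union> {z})))"

definition axiom_DMF :: "'a::order set \<Rightarrow> nat \<Rightarrow> bool" where
  "axiom_DMF P h \<longleftrightarrow>
     (\<forall>I m. d_interval P h I \<and> is_maximum I m \<longrightarrow> (\<forall>x. covered_by P x m \<longrightarrow> x \<in> I))"

definition axiom_DmCF :: "'a::order set \<Rightarrow> nat \<Rightarrow> bool" where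
  "axiom_DmCF P h \<longleftrightarrow>
     (\<forall>S. d_minus_set P h S \<longrightarrow>
        (\<exists>z. d_interval P h (S \<union> {z}) \<and> is_maximum (S \<union> {z}) z \<and>
           (\<forall>x. covered_by P x z \<longrightarrow> x \<in> S)))"

definition axiom_NODm :: "'a::order set \<Rightarrow> nat \<Rightarrow> bool" where
  "axiom_NODm P h \<longleftrightarrow> \<not> (\<exists>S S'. overlapping P h S S')"

definition axiom_DMD :: "'a::order set \<Rightarrow> nat \<Rightarrow> bool" where
  "axiom_DMD P h \<longleftrightarrow>
     (\<forall>I J m n. d_interval P h I \<and> d_interval P h J \<and> I \<noteq> J \<and>
        is_maximum I m \<and> is_maximum J n \<longrightarrow> m \<noteq> n)"

end

theory Submission
  imports Defs
begin

text \<open>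
  All combinations of axioms are reduced to (c), for which the key point is that the top of a
  \<open>d\<^sub>h\<close>-interval over a given \<open>d\<^sub>h\<^sup>-\<close>-set is unique. If \<open>z \<noteq> m\<close> both complete the same set, then
  \<open>{f\<^sub>h\<^sub>-\<^sub>1; z, m}\<close> is a \<open>d\<^sub>3\<^sup>-\<close>-set. Completing it, and then descending along \<open>f\<^sub>h\<^sub>-\<^sub>2, \<dots>, f\<^sub>3\<close> while
  completing the \<open>d\<^sub>j\<^sup>-\<close>-set that arises at each step, produces two \<open>d\<^sub>h\<^sup>-\<close>-sets with bottoms \<open>b\<close> and
  \<open>c\<close> that overlap. Uniqueness shows that the maximum of a \<open>d\<^sub>h\<close>-interval covers exactly the
  coatoms of that interval, and by induction on \<open>h\<close> that a \<open>d\<^sub>h\<^sup>-\<close>-set is determined by its maximal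
  elements. Conversely, overlapping sets have the same maximal elements, so an element covering
  exactly these completes both of them, which contradicts (D\<open>h\<close>MD).
\<close>

section \<open>The double tailed diamond and its truncations, described by heights\<close>

text \<open>A substitute for a rank function: among elements with indices at least 3, only
  \<open>DB\<close> and \<open>DC\<close> are distinct and of equal height, and they form the only
  incomparable pair. The order is therefore integer comparison of heights; the jumps between 0 and 3
  do no harm, as only the order of the values matters.\<close>

definition height :: "ddiamond \<Rightarrow> int" where
  "height x = (case x of DA i \<Rightarrow> - int i | DB \<Rightarrow> 0 | DC \<Rightarrow> 0 | DF i \<Rightarrow> int i)"

lemma height_simps [simp]:
  "height (DA i) = - int i" "height DB = 0" "height DC = 0" "height (DF i) = int i"
  by (simp_all add: height_def)

text \<open>Cutting both tails independently puts all sets of the proof into one family: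
  \<open>d_k(1)\<close> is \<open>truncated k k\<close>, a \<open>d_k^-\<close>-set is a copy of
  \<open>truncated k (k - 1)\<close>, and \<open>truncated q q\<close> is what
  \<open>truncated (Suc q) q\<close> leaves without its bottom. The value 2 stands for an empty
  tail.\<close>

definition truncated :: "nat \<Rightarrow> nat \<Rightarrow> ddiamond set" where
  "truncated p q = DA ` {3..p} \<union> {DB, DC} \<union> DF ` {3..q}"

lemma mem_truncated [simp]:
  "DA i \<in> truncated p q \<longleftrightarrow> 3 \<le> i \<and> i \<le> p"
  "DB \<in> truncated p q" "DC \<in> truncated p q"
  "DF i \<in> truncated p q \<longleftrightarrow> 3 \<le> i \<and> i \<le> q"
  by (auto simp: truncated_def)

lemma truncated_cases:
  assumes "x \<in> truncated p q"
  obtains i where "x = DA i" "3 \<le> i" "i \<le> p" | "x = DB" | "x = DC"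
    | i where "x = DF i" "3 \<le> i" "i \<le> q"
  using assms by (auto simp: truncated_def)

lemma truncated_Suc_top: "2 \<le> q \<Longrightarrow> truncated p (Suc q) = insert (DF (Suc q)) (truncated p q)"
  by (auto simp: truncated_def atLeastAtMostSuc_conv)

lemma truncated_Suc_bot: "2 \<le> p \<Longrightarrow> truncated (Suc p) q = insert (DA (Suc p)) (truncated p q)"
  by (auto simp: truncated_def atLeastAtMostSuc_conv)

lemma ddiamond_carrier_eq: "ddiamond_carrier k = truncated k k"
  by (simp add: ddiamond_carrier_def truncated_def)

lemma ddiamond_carrier_minus: "2 \<le> q \<Longrightarrow> ddiamond_carrier (Suc q) - {DF (Suc q)} = truncated (Suc q) q"
  by (auto simp: ddiamond_carrier_eq truncated_Suc_top)

lemma finite_truncated: "finite (truncated p q)"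
  by (simp add: truncated_def)

lemma card_truncated_Suc: "2 \<le> q \<Longrightarrow> card (truncated p (Suc q)) = Suc (card (truncated p q))"
  by (simp add: truncated_Suc_top finite_truncated)

lemma truncated_mono: "p' \<le> p \<Longrightarrow> q' \<le> q \<Longrightarrow> truncated p' q' \<subseteq> truncated p q"
  by (auto simp: truncated_def)

lemma truncated_height:
  "x \<in> truncated p q \<Longrightarrow> - int p \<le> height x \<and> height x \<le> int q"
  by (auto elim: truncated_cases)

lemma truncated_restrict:
  "x \<in> truncated p q \<Longrightarrow> - int p' \<le> height x \<Longrightarrow> height x \<le> int q' \<Longrightarrow> x \<in> truncated p' q'"
  by (auto elim!: truncated_cases)

lemma height_eq:
  "x \<in> truncated p q \<Longrightarrow> y \<in> truncated p q \<Longrightarrow> height x = height y \<Longrightarrow>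
    x = y \<or> (x = DB \<and> y = DC) \<or> (x = DC \<and> y = DB)"
  by (auto elim!: truncated_cases)

lemma ddiamond_le_DA:
  assumes "3 \<le> i" "i \<le> j" "j \<le> k"
  shows "ddiamond_le k (DA j) (DA i)"
  using assms(2,3) unfolding ddiamond_le_def
proof (induction rule: dec_induct)
  case (step n)
  then have "ddiamond_step k (DA (Suc n)) (DA n)"
    using assms(1) by (intro ddiamond_step.intros) auto
  with step show ?case
    by (meson Suc_leD converse_rtranclp_into_rtranclp)
qed auto

lemma ddiamond_le_DF:
  assumes "3 \<le> i" "i \<le> j" "j \<le> k"
  shows "ddiamond_le k (DF i) (DF j)"
  using assms(2,3) unfolding ddiamond_le_def
proof (induction rule: dec_induct)
  case (step n)
  then have "ddiamond_step k (DF n) (DF (Suc n))"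
    using assms(1) by (intro ddiamond_step.intros) auto
  with step show ?case
    by (meson Suc_leD rtranclp.rtrancl_into_rtrancl)
qed auto

lemma ddiamond_le_trans: "ddiamond_le k x y \<Longrightarrow> ddiamond_le k y z \<Longrightarrow> ddiamond_le k x z"
  unfolding ddiamond_le_def by (rule rtranclp_trans)

text \<open>Every step raises the height, which gives one direction. Conversely, each tail is a
  chain and the two tails are joined through \<open>DB\<close> and \<open>DC\<close>, so elements of
  different height are connected by composing chains.\<close>

lemma ddiamond_le_iff:
  assumes "x \<in> truncated k k" "y \<in> truncated k k"
  shows "ddiamond_le k x y \<longleftrightarrow> x = y \<or> height x < height y"
proof
  have step: "height u < height v" if "ddiamond_step k u v" for u v
    using that by cases auto
  assume "ddiamond_le k x y"
  then have "(ddiamond_step k)\<^sup>*\<^sup>* x y" by (simp add: ddiamond_le_def)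
  then show "x = y \<or> height x < height y"
    by induction (use step in force)+
next
  have A: "ddiamond_le k (DA 3) DB" "ddiamond_le k (DA 3) DC"
    and F: "ddiamond_le k DB (DF 3)" "ddiamond_le k DC (DF 3)"
    by (auto simp: ddiamond_le_def intro: ddiamond_step.intros)
  have AB: "ddiamond_le k (DA i) DB \<and> ddiamond_le k (DA i) DC" if "3 \<le> i" "i \<le> k" for i
    using A ddiamond_le_DA[of 3 i k] that ddiamond_le_trans by blast
  have BF: "ddiamond_le k DB (DF i) \<and> ddiamond_le k DC (DF i)" if "3 \<le> i" "i \<le> k" for i
    using F ddiamond_le_DF[of 3 i k] that ddiamond_le_trans by blast
  have AF: "ddiamond_le k (DA i) (DF j)" if "3 \<le> i" "i \<le> k" "3 \<le> j" "j \<le> k" for i j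
    using AB BF that ddiamond_le_trans by blast
  assume "x = y \<or> height x < height y"
  then show "ddiamond_le k x y"
  proof
    assume "x = y"
    then show ?thesis by (simp add: ddiamond_le_def)
  next
    assume "height x < height y"
    with assms show ?thesis
      by (auto elim!: truncated_cases simp: AB BF AF ddiamond_le_DA ddiamond_le_DF)
  qed
qed

text \<open>The maximal elements of \<open>truncated p q\<close>, whatever \<open>p\<close> is. For
  \<open>q = 2\<close> the upper tail is empty and both \<open>b\<close> and \<open>c\<close> are
  maximal, as in a \<open>d_3^-\<close>-set.\<close>

definition tops :: "nat \<Rightarrow> ddiamond set" where
  "tops q = (if q = 2 then {DB, DC} else {DF q})"

lemma tops_subset: "2 \<le> q \<Longrightarrow> tops q \<subseteq> truncated p q"
  by (auto simp: tops_def)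

lemma below_tops:
  "x \<in> truncated p q \<Longrightarrow> 2 \<le> q \<Longrightarrow> \<exists>t\<in>tops q. x = t \<or> height x < height t"
  by (auto simp: tops_def elim!: truncated_cases)

lemma not_above_tops:
  "x \<in> truncated p q \<Longrightarrow> t \<in> tops q \<Longrightarrow> \<not> height t < height x"
  by (auto simp: tops_def elim!: truncated_cases split: if_splits)

lemma tops_iff:
  "2 \<le> q \<Longrightarrow> x \<in> truncated p q \<Longrightarrow> x \<in> tops q \<longleftrightarrow> \<not> (\<exists>y\<in>truncated p q. height x < height y)"
  using below_tops not_above_tops tops_subset by (metis subsetD)

section \<open>Convex copies of truncated diamonds in a poset\<close>

text \<open>A labelling from the diamond into \<open>P\<close> is easier to cut and to extend than
  an isomorphism defined on a subset of \<open>P\<close>: values off \<open>truncated p q\<close>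
  are free, and adding a top is a function update. Strict monotonicity and incomparability of the
  images of \<open>b\<close> and \<open>c\<close> already force an order embedding.\<close>

definition embedding :: "'a::order set \<Rightarrow> nat \<Rightarrow> nat \<Rightarrow> (ddiamond \<Rightarrow> 'a) \<Rightarrow> bool" where
  "embedding P p q g \<longleftrightarrow>
     convex_in P (g ` truncated p q) \<and>
     (\<forall>x\<in>truncated p q. \<forall>y\<in>truncated p q. height x < height y \<longrightarrow> g x < g y) \<and>
     \<not> g DB \<le> g DC \<and> \<not> g DC \<le> g DB"

lemma embedding_mono:
  "embedding P p q g \<Longrightarrow> x \<in> truncated p q \<Longrightarrow> y \<in> truncated p q \<Longrightarrow> height x < height y \<Longrightarrow> g x < g y"
  by (simp add: embedding_def)

lemma embedding_le_iff:
  assumes "embedding P p q g" "x \<in> truncated p q" "y \<in> truncated p q"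
  shows "g x \<le> g y \<longleftrightarrow> x = y \<or> height x < height y"
proof (cases "height x" "height y" rule: linorder_cases)
  case less
  then show ?thesis using embedding_mono[OF assms] by (simp add: less_imp_le)
next
  case equal
  then show ?thesis using height_eq[OF assms(2,3)] assms(1) by (auto simp: embedding_def)
next
  case greater
  then show ?thesis using embedding_mono[OF assms(1,3,2)] by auto
qed

lemma embedding_less_iff:
  assumes "embedding P p q g" "x \<in> truncated p q" "y \<in> truncated p q"
  shows "g x < g y \<longleftrightarrow> height x < height y"
  using embedding_le_iff[OF assms] embedding_le_iff[OF assms(1,3,2)] by (auto simp: less_le_not_le)

lemma embedding_inj: "embedding P p q g \<Longrightarrow> inj_on g (truncated p q)"
  by (rule inj_onI) (metis embedding_le_iff order_refl less_asym)

lemma embedding_subset: "embedding P p q g \<Longrightarrow> x \<in> truncated p q \<Longrightarrow> g x \<in> P"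
  by (auto simp: embedding_def convex_in_def)

lemma embedding_between:
  assumes "embedding P p q g" "x \<in> truncated p q" "y \<in> truncated p q" "t \<in> P" "g x \<le> t" "t \<le> g y"
  obtains s where "s \<in> truncated p q" "t = g s"
proof -
  have "t \<in> g ` truncated p q"
    using assms unfolding embedding_def convex_in_def by (meson IntI atLeastAtMost_iff imageI subsetD)
  then show ?thesis using that by auto
qed

text \<open>An element of \<open>P\<close> between two images of the smaller truncation is an image
  of the larger one by convexity. Its height is caught between the two heights, so it belongs to the
  smaller truncation.\<close>

lemma embedding_restrict:
  assumes g: "embedding P p q g" and le: "p' \<le> p" "q' \<le> q"
  shows "embedding P p' q' g"
proof -
  note sub = truncated_mono[OF le]
  have "convex_in P (g ` truncated p' q')"
    unfolding convex_in_def
  proof (intro conjI ballI subsetI)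
    fix t assume "t \<in> g ` truncated p' q'"
    then show "t \<in> P" using sub embedding_subset[OF g] by auto
  next
    fix a b t
    assume "a \<in> g ` truncated p' q'" "b \<in> g ` truncated p' q'" and t: "t \<in> {a..b} \<inter> P"
    then obtain x y where x: "x \<in> truncated p' q'" "a = g x" and y: "y \<in> truncated p' q'" "b = g y"
      by auto
    obtain s where s: "s \<in> truncated p q" "t = g s"
      using embedding_between[OF g, of x y t] x y t sub by auto
    have "x = s \<or> height x < height s" "s = y \<or> height s < height y"
      using embedding_le_iff[OF g] x y s t sub by auto
    then have "s \<in> truncated p' q'"
      using truncated_restrict[OF s(1)] truncated_height[OF x(1)] truncated_height[OF y(1)] by fastforce
    then show "t \<in> g ` truncated p' q'" using s by simp
  qed
  moreover have "\<forall>x\<in>truncated p' q'. \<forall>y\<in>truncated p' q'. height x < height y \<longrightarrow> g x < g y"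
    using g sub by (auto simp: embedding_def)
  ultimately show ?thesis using g by (simp add: embedding_def)
qed

text \<open>By convexity no element outside the image comes between two images, so coverings in
  \<open>P\<close> can be read off from heights.\<close>

lemma embedding_covered_iff:
  assumes g: "embedding P p q g" and x: "x \<in> truncated p q" and y: "y \<in> truncated p q"
  shows "covered_by P (g x) (g y) \<longleftrightarrow>
    height x < height y \<and> \<not> (\<exists>s\<in>truncated p q. height x < height s \<and> height s < height y)"
proof -
  have "(\<exists>z\<in>P. g x < z \<and> z < g y) \<longleftrightarrow> (\<exists>s\<in>truncated p q. height x < height s \<and> height s < height y)"
    using embedding_between[OF g x y] embedding_less_iff[OF g] x y embedding_subset[OF g]
    by (metis less_imp_le)
  then show ?thesis
    using embedding_less_iff[OF g x y] embedding_subset[OF g] x y by (auto simp: covered_by_def)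
qed

lemma embedding_maximal:
  assumes g: "embedding P p q g" and q: "2 \<le> q"
  shows "maximal_elements (g ` truncated p q) = g ` tops q"
proof -
  have "maximal_elements (g ` truncated p q) =
      g ` {x \<in> truncated p q. \<not> (\<exists>y\<in>truncated p q. height x < height y)}"
    using embedding_less_iff[OF g] by (auto simp: maximal_elements_def)
  also have "{x \<in> truncated p q. \<not> (\<exists>y\<in>truncated p q. height x < height y)} = tops q"
    using tops_iff[OF q] tops_subset[OF q] by blast
  finally show ?thesis .
qed

text \<open>This concerns elements of the copy only. That the top covers nothing else in
  \<open>P\<close> depends on the axioms and is the content of
  \<open>embedding_top_covers\<close>.\<close>

lemma embedding_coatoms:
  assumes g: "embedding P p (Suc q) g" and q: "2 \<le> q"
  shows "x \<in> g ` truncated p (Suc q) \<and> covered_by P x (g (DF (Suc q))) \<longleftrightarrow> x \<in> g ` tops q"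
proof -
  have *: "covered_by P (g s) (g (DF (Suc q))) \<longleftrightarrow> s \<in> tops q" if s: "s \<in> truncated p (Suc q)" for s
  proof (cases "s = DF (Suc q)")
    case True
    then show ?thesis by (auto simp: covered_by_def tops_def)
  next
    case False
    then have s': "s \<in> truncated p q" using s truncated_Suc_top[OF q] by auto
    have "height r < int (Suc q)" if "r \<in> truncated p q" for r
      using truncated_height[OF that] by simp
    then show ?thesis
      using embedding_covered_iff[OF g s, of "DF (Suc q)"] s' q tops_iff[OF q s']
      by (auto simp: truncated_Suc_top)
  qed
  have "tops q \<subseteq> truncated p (Suc q)" using tops_subset[OF q] truncated_mono[of p p q "Suc q"] by auto
  then show ?thesis using * by auto
qed

lemma embedding_maximum:
  assumes g: "embedding P p q g" and q: "3 \<le> q"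
  shows "is_maximum (g ` truncated p q) m \<longleftrightarrow> m = g (DF q)"
proof -
  have *: "is_maximum (g ` truncated p q) (g (DF q))"
    unfolding is_maximum_def
  proof safe
    fix x assume x: "x \<in> truncated p q"
    then have "x = DF q \<or> height x < height (DF q)"
      using below_tops[OF x] q by (auto simp: tops_def)
    then show "g x \<le> g (DF q)" using embedding_le_iff[OF g x] q by auto
  qed (use q in auto)
  then show ?thesis unfolding is_maximum_def by (metis order_antisym)
qed

lemma embedding_minimum:
  assumes g: "embedding P p q g" and p: "3 \<le> p" and x: "x \<in> truncated p q"
  shows "g (DA p) \<le> g x"
  using embedding_le_iff[OF g _ x, of "DA p"] p x by (auto elim!: truncated_cases)

lemma embedding_interval:
  assumes g: "embedding P p q g" and "3 \<le> p" "3 \<le> q"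
  shows "g ` truncated p q = {g (DA p)..g (DF q)} \<inter> P"
proof -
  have "is_maximum (g ` truncated p q) (g (DF q))" using embedding_maximum[OF g] assms by simp
  moreover have "t \<in> g ` truncated p q" if "t \<in> P" "g (DA p) \<le> t" "t \<le> g (DF q)" for t
    using embedding_between[OF g _ _ that] assms by force
  ultimately show ?thesis
    using embedding_minimum[OF g] embedding_subset[OF g] assms by (auto simp: is_maximum_def)
qed

section \<open>Intervals and \<open>d_h^-\<close>-sets in terms of embeddings\<close>

lemma convex_isomorphic_iff:
  assumes "q \<le> k"
  shows "convex_in P S \<and> order_isomorphic S (truncated k q) (ddiamond_le k) \<longleftrightarrow>
    (\<exists>g. embedding P k q g \<and> S = g ` truncated k q)"
proof
  let ?T = "truncated k q"
  have sub: "?T \<subseteq> truncated k k" using truncated_mono[of k k q k] assms by simp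
  {
    assume L: "convex_in P S \<and> order_isomorphic S ?T (ddiamond_le k)"
    then obtain f where f: "bij_betw f S ?T" "\<And>x y. x \<in> S \<Longrightarrow> y \<in> S \<Longrightarrow> x \<le> y \<longleftrightarrow> ddiamond_le k (f x) (f y)"
      by (auto simp: order_isomorphic_def)
    \<comment> \<open>Embeddings run from the diamond into the poset, hence the inverse of the
      isomorphism.\<close>
    define g where "g = inv_into S f"
    have S: "S = g ` ?T" using bij_betw_inv_into[OF f(1)] by (simp add: g_def bij_betw_def)
    have iff: "g x \<le> g y \<longleftrightarrow> x = y \<or> height x < height y" if "x \<in> ?T" "y \<in> ?T" for x y
    proof -
      have "f (g x) = x" "f (g y) = y" using that f(1) by (simp_all add: g_def bij_betw_inv_into_right)
      then show ?thesis using f(2)[of "g x" "g y"] ddiamond_le_iff[of x k y] that S sub by auto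
    qed
    have "embedding P k q g"
      using L S iff by (auto simp: embedding_def less_le_not_le)
    then show "\<exists>g. embedding P k q g \<and> S = g ` ?T" using S by blast
  }
  {
    assume "\<exists>g. embedding P k q g \<and> S = g ` ?T"
    then obtain g where g: "embedding P k q g" and S: "S = g ` ?T" by blast
    let ?f = "inv_into ?T g"
    have "bij_betw g ?T S" using embedding_inj[OF g] S by (simp add: bij_betw_def)
    then have "bij_betw ?f S ?T" by (rule bij_betw_inv_into)
    moreover have "\<forall>x\<in>S. \<forall>y\<in>S. x \<le> y \<longleftrightarrow> ddiamond_le k (?f x) (?f y)"
      using embedding_inj[OF g] embedding_le_iff[OF g] ddiamond_le_iff[of _ k] sub
      by (auto simp: S subset_iff)
    ultimately have "order_isomorphic S ?T (ddiamond_le k)" by (auto simp: order_isomorphic_def)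
    moreover have "convex_in P S" using g S by (simp add: embedding_def)
    ultimately show "convex_in P S \<and> order_isomorphic S ?T (ddiamond_le k)" by blast
  }
qed

lemma d_minus_set_iff:
  "2 \<le> q \<Longrightarrow> d_minus_set P (Suc q) S \<longleftrightarrow>
    (\<exists>g. embedding P (Suc q) q g \<and> S = g ` truncated (Suc q) q)"
  by (simp only: d_minus_set_def ddiamond_carrier_minus convex_isomorphic_iff le_SucI order_refl)

text \<open>An interval is convex. Conversely, a convex copy with both tails nonempty has a minimum
  and a maximum, so it is the interval between them.\<close>

lemma d_interval_iff:
  assumes "2 \<le> q"
  shows "d_interval P (Suc q) I \<longleftrightarrow>
    (\<exists>g. embedding P (Suc q) (Suc q) g \<and> I = g ` truncated (Suc q) (Suc q))"
proof
  assume "d_interval P (Suc q) I"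
  moreover from this have "convex_in P I" by (auto simp: d_interval_def convex_in_def)
  ultimately show "\<exists>g. embedding P (Suc q) (Suc q) g \<and> I = g ` truncated (Suc q) (Suc q)"
    using convex_isomorphic_iff[of "Suc q" "Suc q" P I] by (auto simp: d_interval_def ddiamond_carrier_eq)
next
  assume "\<exists>g. embedding P (Suc q) (Suc q) g \<and> I = g ` truncated (Suc q) (Suc q)"
  then obtain g where g: "embedding P (Suc q) (Suc q) g" and I: "I = g ` truncated (Suc q) (Suc q)" by blast
  have "I = {g (DA (Suc q))..g (DF (Suc q))} \<inter> P" using embedding_interval[OF g] I assms by simp
  moreover have "g (DA (Suc q)) \<in> P" "g (DF (Suc q)) \<in> P" using embedding_subset[OF g] assms by auto
  ultimately show "d_interval P (Suc q) I"
    using convex_isomorphic_iff[of "Suc q" "Suc q" P I] g I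
    unfolding d_interval_def ddiamond_carrier_eq by blast
qed

section \<open>Adding a maximum to a \<open>d_h^-\<close>-set\<close>

lemma convex_inD:
  "convex_in P S \<Longrightarrow> x \<in> S \<Longrightarrow> y \<in> S \<Longrightarrow> t \<in> P \<Longrightarrow> x \<le> t \<Longrightarrow> t \<le> y \<Longrightarrow> t \<in> S"
  unfolding convex_in_def by (meson IntI atLeastAtMost_iff subsetD)

text \<open>A maximal element of the finite set of elements from \<open>x\<close> up to but
  excluding \<open>z\<close> is covered by \<open>z\<close>. Local finiteness enters the whole proof
  through this fact.\<close>

lemma below_coatom:
  assumes "locally_finite P" "x \<in> P" "z \<in> P" "x < z"
  obtains y where "covered_by P y z" "x \<le> y"
proof -
  have "finite ({x..z} \<inter> P - {z})" using assms by (simp add: locally_finite_def)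
  then obtain y where y: "y \<in> {x..z} \<inter> P - {z}" "x \<le> y"
    and max: "\<And>t. t \<in> {x..z} \<inter> P - {z} \<Longrightarrow> y \<le> t \<Longrightarrow> y = t"
    using finite_has_maximal2[of "{x..z} \<inter> P - {z}" x] assms by force
  have "covered_by P y z"
    unfolding covered_by_def
  proof safe
    fix t assume t: "t \<in> P" "y < t" "t < z"
    have "x \<le> t" by (rule order_trans[OF y(2) less_imp_le[OF t(2)]])
    then have "t \<in> {x..z} \<inter> P - {z}" using t(1,3) by (simp add: less_le)
    then show False using max[OF _ less_imp_le[OF t(2)]] t(2) by simp
  qed (use y assms in auto)
  then show ?thesis using y that by blast
qed

text \<open>Only convexity is at stake. An element strictly below \<open>z\<close> lies below some
  element covered by \<open>z\<close>, which is a maximal element of the old copy, and then the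
  convexity of the old copy applies.\<close>

lemma embedding_extend:
  assumes fin: "locally_finite P" and g: "embedding P p q g" and q: "2 \<le> q"
    and z: "z \<in> P" "{x. covered_by P x z} = g ` tops q"
  shows "embedding P p (Suc q) (g(DF (Suc q) := z))"
proof -
  let ?g = "g(DF (Suc q) := z)"
  have neq: "s \<noteq> DF (Suc q)" if "s \<in> truncated p q" for s using that by auto
  have img: "?g ` truncated p (Suc q) = insert z (g ` truncated p q)"
    using neq by (auto simp: truncated_Suc_top[OF q] image_iff)
  have less: "g s < z" if s: "s \<in> truncated p q" for s
  proof -
    obtain t where t: "t \<in> tops q" "s = t \<or> height s < height t" using below_tops[OF s q] by blast
    then have "g s \<le> g t" using embedding_le_iff[OF g s] tops_subset[OF q] by blast
    also have "g t < z" using z(2) t(1) by (auto simp: covered_by_def)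
    finally show ?thesis .
  qed
  have conv: "convex_in P (g ` truncated p q)" using g by (simp add: embedding_def)
  have "convex_in P (insert z (g ` truncated p q))"
    unfolding convex_in_def
  proof (intro conjI ballI subsetI)
    fix t assume "t \<in> insert z (g ` truncated p q)"
    then show "t \<in> P" using z conv by (auto simp: convex_in_def)
  next
    fix a b t
    assume a: "a \<in> insert z (g ` truncated p q)" and b: "b \<in> insert z (g ` truncated p q)"
      and t: "t \<in> {a..b} \<inter> P"
    show "t \<in> insert z (g ` truncated p q)"
    proof (cases "t = z")
      case False
      obtain c where c: "c \<in> g ` truncated p q" "t \<le> c"
      proof (cases "b = z")
        case True
        then have "t < z" using t False by auto
        then obtain y where "covered_by P y z" "t \<le> y" using below_coatom[OF fin _ z(1)] t by blast
        then show ?thesis using that z(2) tops_subset[OF q] by blast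
      next
        case False
        then show ?thesis using that b t by auto
      qed
      have "a \<le> t" "t \<in> P" using t by auto
      moreover have "c < z" using c(1) less by blast
      ultimately have "a < z" using c(2) by (metis order_trans le_less_trans)
      then have "a \<in> g ` truncated p q" using a by blast
      then show ?thesis using convex_inD[OF conv _ c(1) \<open>t \<in> P\<close> \<open>a \<le> t\<close> c(2)] by blast
    qed simp
  qed
  moreover have "?g x < ?g y"
    if "x \<in> truncated p (Suc q)" "y \<in> truncated p (Suc q)" "height x < height y" for x y
  proof -
    have "x \<noteq> DF (Suc q)" using that(3) truncated_height[OF that(2)] by auto
    then have "x \<in> truncated p q" using that(1) by (simp add: truncated_Suc_top[OF q])
    then show ?thesis using that less embedding_mono[OF g] by (auto simp: truncated_Suc_top[OF q])
  qed
  ultimately show ?thesis using g img by (simp add: embedding_def)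
qed

text \<open>The interval comes with a labelling of its own, unrelated to \<open>g\<close>. The point
  is that \<open>g\<close> itself extends by \<open>z\<close>, so that later arguments can keep the
  given labels.\<close>

lemma embedding_interval_singleton:
  assumes q: "2 \<le> q" and g: "embedding P (Suc q) q g"
    and I: "d_interval P (Suc q) (g ` truncated (Suc q) q \<union> {z})"
    and max: "is_maximum (g ` truncated (Suc q) q \<union> {z}) z"
  shows "embedding P (Suc q) (Suc q) (g(DF (Suc q) := z))"
    and "z \<notin> g ` truncated (Suc q) q"
proof -
  let ?S = "g ` truncated (Suc q) q"
  obtain f where f: "embedding P (Suc q) (Suc q) f" "?S \<union> {z} = f ` truncated (Suc q) (Suc q)"
    using I d_interval_iff[OF q] by blast
  \<comment> \<open>By counting: a \<open>d_h\<close>-interval has one element more than a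
    \<open>d_h^-\<close>-set.\<close>
  show z: "z \<notin> ?S"
  proof
    assume "z \<in> ?S"
    then have "?S = f ` truncated (Suc q) (Suc q)" using f(2) by auto
    then have "card (truncated (Suc q) q) = card (truncated (Suc q) (Suc q))"
      using card_image[OF embedding_inj[OF g]] card_image[OF embedding_inj[OF f(1)]] by simp
    then show False using card_truncated_Suc[OF q] by simp
  qed
  let ?g = "g(DF (Suc q) := z)"
  have img: "?g ` truncated (Suc q) (Suc q) = ?S \<union> {z}"
    by (auto simp: truncated_Suc_top[OF q] image_iff)
  have "?g x < ?g y"
    if "x \<in> truncated (Suc q) (Suc q)" "y \<in> truncated (Suc q) (Suc q)" "height x < height y" for x y
  proof -
    have "x \<noteq> DF (Suc q)" using that(3) truncated_height[OF that(2)] by auto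
    then have x: "x \<in> truncated (Suc q) q" using that(1) by (simp add: truncated_Suc_top[OF q])
    then have "g x < z" using max z by (auto simp: is_maximum_def order.strict_iff_order)
    then show ?thesis
      using that x \<open>x \<noteq> DF (Suc q)\<close> embedding_mono[OF g x]
      by (auto simp: truncated_Suc_top[OF q])
  qed
  moreover have "convex_in P (?S \<union> {z})" using f by (simp add: embedding_def)
  ultimately show "embedding P (Suc q) (Suc q) ?g" using g img by (simp add: embedding_def)
qed

text \<open>The axiom confines the elements covered by \<open>z\<close> to the
  \<open>d_h^-\<close>-set, and inside it \<open>embedding_coatoms\<close> identifies them as the
  maximal ones.\<close>

lemma embedding_DmCF:
  assumes "axiom_DmCF P (Suc q)" and q: "2 \<le> q" and g: "embedding P (Suc q) q g"
  obtains z where "embedding P (Suc q) (Suc q) (g(DF (Suc q) := z))"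
    and "z \<in> P" and "{x. covered_by P x z} = g ` tops q"
proof -
  let ?S = "g ` truncated (Suc q) q"
  have "d_minus_set P (Suc q) ?S" using d_minus_set_iff[OF q] g by blast
  then obtain z where z: "d_interval P (Suc q) (?S \<union> {z})" "is_maximum (?S \<union> {z}) z"
    and cov: "\<And>x. covered_by P x z \<Longrightarrow> x \<in> ?S"
    using assms(1) unfolding axiom_DmCF_def by blast
  let ?g = "g(DF (Suc q) := z)"
  have g': "embedding P (Suc q) (Suc q) ?g" by (rule embedding_interval_singleton[OF q g z])
  have img: "?g ` truncated (Suc q) (Suc q) = ?S \<union> {z}"
    by (auto simp: truncated_Suc_top[OF q] image_iff)
  have tops: "?g ` tops q = g ` tops q" by (auto simp: tops_def)
  have "covered_by P x z \<longleftrightarrow> x \<in> g ` tops q" for x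
    using embedding_coatoms[OF g' q, of x] cov[of x] unfolding img tops by auto
  then have "{x. covered_by P x z} = g ` tops q" by blast
  moreover have "z \<in> P" using embedding_subset[OF g', of "DF (Suc q)"] q by simp
  ultimately show ?thesis using that g' by blast
qed

section \<open>Uniqueness of the top and its consequences\<close>

text \<open>If one top were below the other, it would lie between a common lower element and the
  other top, hence in the other copy by convexity. There only the top itself is higher than the
  elements of \<open>tops q\<close>.\<close>

lemma tops_embedding_incomparable:
  assumes q: "2 \<le> q" and g: "embedding P p (Suc q) g" and f: "embedding P p (Suc q) f"
    and eq: "\<And>s. s \<in> truncated p q \<Longrightarrow> f s = g s"
    and le: "g (DF (Suc q)) \<le> f (DF (Suc q))"
  shows "g (DF (Suc q)) = f (DF (Suc q))"
proof -
  obtain t where t: "t \<in> tops q" using tops_def by fastforce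
  have tq: "t \<in> truncated p q" using t tops_subset[OF q] by blast
  then have t': "t \<in> truncated p (Suc q)" using truncated_mono[of p p q "Suc q"] by auto
  have ht: "height t < int (Suc q)" using truncated_height[OF tq] by simp
  have top: "DF (Suc q) \<in> truncated p (Suc q)" using q by simp
  have less: "f t < g (DF (Suc q))" using eq[OF tq] embedding_mono[OF g t' top] ht by simp
  obtain s where s: "s \<in> truncated p (Suc q)" "g (DF (Suc q)) = f s"
    using embedding_between[OF f t' top _ _ le] less embedding_subset[OF g top] by (metis less_imp_le)
  have "height t < height s" using less s embedding_less_iff[OF f t' s(1)] by simp
  then have "s \<notin> truncated p q" using not_above_tops[OF _ t] by blast
  then show ?thesis using s by (simp add: truncated_Suc_top[OF q])
qed

text \<open>The form in which overlap is produced and excluded: two \<open>d_h^-\<close>-sets that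
  agree apart from their bottoms.\<close>

lemma overlapping_embeddings:
  assumes q: "2 \<le> q" and g: "embedding P (Suc q) q g" and f: "embedding P (Suc q) q f"
    and neq: "g (DA (Suc q)) \<noteq> f (DA (Suc q))"
    and eq: "g ` truncated q q = f ` truncated q q"
  shows "overlapping P (Suc q) (g ` truncated (Suc q) q) (f ` truncated (Suc q) q)"
proof -
  have d: "d_minus_set P (Suc q) (g ` truncated (Suc q) q)" "d_minus_set P (Suc q) (f ` truncated (Suc q) q)"
    using d_minus_set_iff[OF q] g f by blast+
  show ?thesis
  proof (cases "q = 2")
    case True
    have 22: "truncated 2 2 = {DB, DC}" by (auto simp: truncated_def)
    then have 32: "truncated 3 2 = {DA 3, DB, DC}" using truncated_Suc_bot[of 2 2] by simp
    have cov: "covered_by P (h (DA 3)) (h DB) \<and> covered_by P (h (DA 3)) (h DC)"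
      if "embedding P 3 2 h" for h
      using embedding_covered_iff[OF that] by (auto simp: 32)
    \<comment> \<open>Equality of images leaves open whether the labels \<open>b\<close> and
      \<open>c\<close> are interchanged, so only the unordered pairs agree.\<close>
    have gf: "{g DB, g DC} = {f DB, f DC}" using eq 22 True by simp
    have "covered_by P (f (DA 3)) (g DB)" "covered_by P (f (DA 3)) (g DC)"
      using cov[of f] f gf True by (auto simp: doubleton_eq_iff)
    moreover have "f ` truncated 3 2 = {f (DA 3), g DB, g DC}" using gf by (simp add: 32)
    moreover have "g ` truncated 3 2 = {g (DA 3), g DB, g DC}" by (simp add: 32)
    ultimately show ?thesis
      using d neq cov[of g] g True unfolding overlapping_def by (simp only: Suc_numeral) auto
  next
    case False
    then have q3: "3 \<le> q" using q by simp
    have mem: "DA q \<in> truncated q q" "DF q \<in> truncated q q" using q3 by auto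
    have sub: "embedding P q q g" "embedding P q q f"
      using embedding_restrict[of P "Suc q" q _ q q] g f by auto
    \<comment> \<open>The common top and the common atom of the two intervals are the maximum and
      the minimum of the shared image.\<close>
    have z: "g (DF q) = f (DF q)"
      using embedding_maximum[OF sub(1) q3] embedding_maximum[OF sub(2) q3] eq by metis
    have u: "g (DA q) = f (DA q)"
      using embedding_minimum[OF sub(1) q3] embedding_minimum[OF sub(2) q3] eq mem
      by (metis (no_types, lifting) antisym imageE imageI)
    have bot: "DA (Suc q) \<in> truncated (Suc q) q" "DA q \<in> truncated (Suc q) q" using q3 by auto
    have atom: "covered_by P (h (DA (Suc q))) (h s) \<longleftrightarrow> s = DA q"
      if h: "embedding P (Suc q) q h" and s: "s \<in> truncated (Suc q) q" for h s
    proof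
      assume "s = DA q"
      then show "covered_by P (h (DA (Suc q))) (h s)"
        using embedding_covered_iff[OF h bot] by (auto elim!: truncated_cases)
    next
      assume "covered_by P (h (DA (Suc q))) (h s)"
      then have "height (DA (Suc q)) < height s"
        and "\<not> (\<exists>r\<in>truncated (Suc q) q. height (DA (Suc q)) < height r \<and> height r < height s)"
        using embedding_covered_iff[OF h bot(1) s] by blast+
      moreover have "height (DA (Suc q)) < height (DA q)" by simp
      ultimately have "height (DA (Suc q)) < height s" "\<not> height (DA q) < height s"
        using bot(2) by blast+
      then show "s = DA q" using s q3 by (auto elim!: truncated_cases)
    qed
    have "{v \<in> g ` truncated (Suc q) q. covered_by P (g (DA (Suc q))) v} = {g (DA q)}"
      using atom[OF g] bot(2) by auto
    moreover have "covered_by P (f (DA (Suc q))) (g (DA q))" using atom[OF f bot(2)] u by simp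
    moreover have "g ` truncated (Suc q) q = {g (DA (Suc q))..g (DF q)} \<inter> P"
      "f ` truncated (Suc q) q = {f (DA (Suc q))..g (DF q)} \<inter> P"
      using embedding_interval[OF g] embedding_interval[OF f] q3 z by simp_all
    moreover have "g (DA (Suc q)) \<in> P" "f (DA (Suc q)) \<in> P" "g (DF q) \<in> P"
      using embedding_subset[OF g] embedding_subset[OF f] bot(1) q3 by auto
    ultimately show ?thesis using d neq q3 unfolding overlapping_def by auto
  qed
qed

text \<open>The two labellings differ only at the bottom \<open>DA h\<close>, so they have the same
  maximal elements at each stage. One new element covering exactly these extends both labellings at
  once.\<close>

lemma embedding_pair_climb:
  assumes fin: "locally_finite P" and ax: "\<And>j. 3 \<le> j \<Longrightarrow> j < h \<Longrightarrow> axiom_DmCF P j"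
    and r: "embedding P h 2 r" "embedding P h 2 r'" "\<And>s. s \<noteq> DA h \<Longrightarrow> r s = r' s"
    and q: "2 \<le> q" "q < h"
  shows "\<exists>s s'. embedding P h q s \<and> embedding P h q s' \<and> (\<forall>x. x \<noteq> DA h \<longrightarrow> s x = s' x) \<and>
    s (DA h) = r (DA h) \<and> s' (DA h) = r' (DA h)"
  using q
proof (induction q rule: dec_induct)
  case base
  then show ?case using r by blast
next
  case (step q)
  have "q < h" using step.prems by simp
  then obtain s s' where s: "embedding P h q s" "embedding P h q s'" "\<And>x. x \<noteq> DA h \<Longrightarrow> s x = s' x"
    "s (DA h) = r (DA h)" "s' (DA h) = r' (DA h)" using step.IH by blast
  \<comment> \<open>Forgetting the lower part of the long tail leaves a
    \<open>d_(q+1)^-\<close>-set, to which the axiom of index \<open>Suc q\<close> applies.\<close>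
  have "embedding P (Suc q) q s" using embedding_restrict[OF s(1)] step.prems by simp
  moreover have "axiom_DmCF P (Suc q)" using ax step.hyps step.prems by simp
  ultimately obtain z where z: "z \<in> P" "{x. covered_by P x z} = s ` tops q"
    using embedding_DmCF[OF _ step.hyps(1)] by metis
  have "s ` tops q = s' ` tops q" by (intro image_cong refl s(3)) (auto simp: tops_def split: if_splits)
  then have z': "{x. covered_by P x z} = s' ` tops q" using z(2) by simp
  have "embedding P h (Suc q) (s(DF (Suc q) := z))"
    by (rule embedding_extend[OF fin s(1) step.hyps(1) z])
  moreover have "embedding P h (Suc q) (s'(DF (Suc q) := z))"
    by (rule embedding_extend[OF fin s(2) step.hyps(1) z(1) z'])
  moreover have "\<forall>x. x \<noteq> DA h \<longrightarrow> (s(DF (Suc q) := z)) x = (s'(DF (Suc q) := z)) x"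
    using s(3) by simp
  moreover have "(s(DF (Suc q) := z)) (DA h) = r (DA h)" "(s'(DF (Suc q) := z)) (DA h) = r' (DA h)"
    using s(4,5) by simp_all
  ultimately show ?case by blast
qed

text \<open>
  The image is the poset \<open>\<beta> \<rightarrow> f\<^sub>3 \<rightarrow> \<dots> \<rightarrow> f\<^sub>q \<rightarrow> {z, m}\<close>, where \<open>\<beta>\<close> is \<open>b\<close> or \<open>c\<close> and \<open>z\<close>, \<open>m\<close> are the two
  tops; the junk value \<open>undefined\<close> is harmless because no \<open>DF i\<close> lies in \<open>truncated _ 2\<close>.
\<close>

lemma embedding_two_tops:
  assumes q: "2 \<le> q" and g: "embedding P (Suc q) (Suc q) g" and f: "embedding P (Suc q) (Suc q) f"
    and eq: "\<And>s. s \<in> truncated (Suc q) q \<Longrightarrow> f s = g s"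
    and neq: "g (DF (Suc q)) \<noteq> f (DF (Suc q))"
    and \<beta>: "\<beta> = DB \<or> \<beta> = DC"
  shows "embedding P (Suc q) 2
    (case_ddiamond (\<lambda>i. if i = Suc q then g \<beta> else g (DF (q + 3 - i))) (g (DF (Suc q))) (f (DF (Suc q))) undefined)"
    (is "embedding P _ 2 ?r")
proof -
  let ?z = "g (DF (Suc q))" and ?m = "f (DF (Suc q))"
  let ?A = "insert \<beta> (DF ` {3..q})"
  let ?T = "truncated (Suc q) (Suc q)"
  \<comment> \<open>The two tops are to become \<open>b\<close> and \<open>c\<close> of the new
    diamond, so they must be incomparable.\<close>
  have inc: "\<not> ?z \<le> ?m" "\<not> ?m \<le> ?z"
    using tops_embedding_incomparable[OF q g f] tops_embedding_incomparable[OF q f g] eq neq by auto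
  have A: "?A \<subseteq> truncated (Suc q) q" using \<beta> by auto
  have AT: "?A \<subseteq> ?T" and top: "DF (Suc q) \<in> ?T" and \<beta>T: "\<beta> \<in> ?T" using \<beta> q by auto
  \<comment> \<open>The chain is read downwards: \<open>DA 3\<close> goes to \<open>DF q\<close> and
    \<open>DA q\<close> to \<open>DF 3\<close>, since indices start at 3, and the last label
    \<open>DA (Suc q)\<close> goes to \<open>\<beta>\<close>.\<close>
  define e where "e i = (if i = Suc q then \<beta> else DF (q + 3 - i))" for i
  have r: "?r (DA i) = g (e i)" for i by (simp add: e_def)
  have e: "e i \<in> ?A" if "3 \<le> i" "i \<le> Suc q" for i
  proof (cases "i = Suc q")
    case False
    then have "q + 3 - i \<in> {3..q}" using that by auto
    then have "DF (q + 3 - i) \<in> ?A" by blast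
    then show ?thesis using False by (simp only: e_def if_False)
  qed (simp add: e_def)
  have e_height: "height (e i) < height (e j)" if "3 \<le> j" "j < i" "i \<le> Suc q" for i j
    using that \<beta> by (auto simp: e_def)
  have img: "?r ` truncated (Suc q) 2 = insert ?z (insert ?m (g ` ?A))"
  proof
    show "?r ` truncated (Suc q) 2 \<subseteq> insert ?z (insert ?m (g ` ?A))"
    proof (rule image_subsetI)
      fix x assume "x \<in> truncated (Suc q) 2"
      then show "?r x \<in> insert ?z (insert ?m (g ` ?A))"
      proof (cases rule: truncated_cases)
        case (1 i)
        then have "?r x = g (e i)" using r by simp
        then show ?thesis using e[OF 1(2,3)] by blast
      qed simp_all
    qed
    have "g (DF i) \<in> ?r ` truncated (Suc q) 2" if "3 \<le> i" "i \<le> q" for i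
      using that by (intro image_eqI[of _ _ "DA (q + 3 - i)"]) auto
    moreover have "g \<beta> \<in> ?r ` truncated (Suc q) 2"
      using q by (intro image_eqI[of _ _ "DA (Suc q)"]) auto
    moreover have "?z \<in> ?r ` truncated (Suc q) 2" by (intro image_eqI[of _ _ DB]) auto
    moreover have "?m \<in> ?r ` truncated (Suc q) 2" by (intro image_eqI[of _ _ DC]) auto
    ultimately show "insert ?z (insert ?m (g ` ?A)) \<subseteq> ?r ` truncated (Suc q) 2" by auto
  qed
  \<comment> \<open>Passing to elements above \<open>\<beta>\<close> drops the lower tail and the
    other one of \<open>b\<close>, \<open>c\<close>, so only a chain remains.\<close>
  have above: "t \<in> k ` insert (DF (Suc q)) ?A"
    if k: "embedding P (Suc q) (Suc q) k" and t: "t \<in> P" "k \<beta> \<le> t" "t \<le> k (DF (Suc q))" for k t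
  proof -
    obtain s where s: "s \<in> ?T" "t = k s" using embedding_between[OF k \<beta>T top t] .
    then have "\<beta> = s \<or> height \<beta> < height s" using embedding_le_iff[OF k \<beta>T] t by simp
    then have "s \<in> insert (DF (Suc q)) ?A"
      using s(1) \<beta> by (auto elim!: truncated_cases simp: le_Suc_eq)
    then show ?thesis using s(2) by blast
  qed
  have fg: "f ` ?A = g ` ?A" using eq A by (intro image_cong) auto
  have f\<beta>: "f \<beta> = g \<beta>" using eq \<beta> by auto
  have Az: "g s \<le> ?z" if "s \<in> ?A" for s
    using embedding_le_iff[OF g _ top, of s] that AT \<beta> by auto
  have \<beta>A: "g \<beta> \<le> g s" if "s \<in> ?A" for s
    using embedding_le_iff[OF g \<beta>T, of s] that AT \<beta> by auto
  have \<beta>z: "g \<beta> \<le> ?z" using Az by simp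
  have \<beta>m: "g \<beta> \<le> ?m"
    using embedding_le_iff[OF f \<beta>T top] f\<beta> \<beta> by auto
  have "convex_in P (insert ?z (insert ?m (g ` ?A)))"
    unfolding convex_in_def
  proof (intro conjI ballI subsetI)
    fix t assume "t \<in> insert ?z (insert ?m (g ` ?A))"
    then show "t \<in> P" using embedding_subset[OF g] embedding_subset[OF f] AT top by blast
  next
    fix a b t
    assume a: "a \<in> insert ?z (insert ?m (g ` ?A))" and b: "b \<in> insert ?z (insert ?m (g ` ?A))"
      and t: "t \<in> {a..b} \<inter> P"
    have "g \<beta> \<le> a" using a \<beta>z \<beta>m \<beta>A by blast
    then have "g \<beta> \<le> t" using t order_trans by (metis IntD1 atLeastAtMost_iff)
    have tP: "t \<in> P" and "t \<le> b" using t by auto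
    \<comment> \<open>Every element of the new set is below one of the two tops, so convexity
      reduces to the two given intervals, which share the chain.\<close>
    have "b \<le> ?z \<or> b = ?m" using b Az order_refl[of ?z] by blast
    then have "t \<le> ?z \<or> t \<le> ?m" using \<open>t \<le> b\<close> order_trans by blast
    then show "t \<in> insert ?z (insert ?m (g ` ?A))"
    proof
      assume "t \<le> ?z"
      then show ?thesis using above[OF g tP \<open>g \<beta> \<le> t\<close>] by blast
    next
      assume "t \<le> ?m"
      then have "t \<in> f ` insert (DF (Suc q)) ?A" using above[OF f tP] \<open>g \<beta> \<le> t\<close> f\<beta> by simp
      also have "\<dots> = insert ?m (g ` ?A)" by (subst image_insert, subst fg, rule refl)
      finally show ?thesis by blast
    qed
  qed
  moreover have "?r x < ?r y"
    if x: "x \<in> truncated (Suc q) 2" and y: "y \<in> truncated (Suc q) 2" and xy: "height x < height y" for x y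
  proof -
    have gm: "g s < ?m" if "s \<in> ?A" for s
      using embedding_mono[OF f _ top, of s] that AT A eq[of s] \<beta> by auto
    have gz: "g s < ?z" if "s \<in> ?A" for s
      using embedding_mono[OF g _ top, of s] that AT \<beta> by auto
    have gg: "g s < g s'" if "s \<in> ?A" "s' \<in> ?A" "height s < height s'" for s s'
      using embedding_mono[OF g _ _ that(3)] that AT by blast
    obtain i where i: "x = DA i" "3 \<le> i" "i \<le> Suc q"
      using x y xy by (auto elim!: truncated_cases)
    from y show ?thesis
    proof (cases rule: truncated_cases)
      case (1 j)
      have "j < i" using xy i(1) 1(1) by simp
      then have "g (e i) < g (e j)" using gg[OF e e e_height] i(2,3) 1(2,3) by blast
      then show ?thesis by (simp only: i(1) 1(1) r)
    next
      case 2
      then show ?thesis using gz[OF e[OF i(2,3)]] i(1) r[of i] by simp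
    next
      case 3
      then show ?thesis using gm[OF e[OF i(2,3)]] i(1) r[of i] by simp
    qed simp
  qed
  ultimately show ?thesis using img inc by (simp add: embedding_def)
qed

lemma embedding_top_unique:
  assumes fin: "locally_finite P" and q: "2 \<le> q"
    and ax: "\<And>j. 3 \<le> j \<Longrightarrow> j \<le> q \<Longrightarrow> axiom_DmCF P j" and nod: "axiom_NODm P (Suc q)"
    and g: "embedding P (Suc q) (Suc q) g" and f: "embedding P (Suc q) (Suc q) f"
    and eq: "\<And>s. s \<in> truncated (Suc q) q \<Longrightarrow> f s = g s"
  shows "f (DF (Suc q)) = g (DF (Suc q))"
proof (rule ccontr)
  \<comment> \<open>The labellings for \<open>b\<close> and for \<open>c\<close> share the two tops
    and the chain of \<open>f\<close>s; they differ only at their bottom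
    \<open>DA (Suc q)\<close>.\<close>
  define r where "r \<beta> = case_ddiamond (\<lambda>i. if i = Suc q then g \<beta> else g (DF (q + 3 - i)))
    (g (DF (Suc q))) (f (DF (Suc q))) undefined" for \<beta>
  assume "f (DF (Suc q)) \<noteq> g (DF (Suc q))"
  then have r: "embedding P (Suc q) 2 (r DB)" "embedding P (Suc q) 2 (r DC)"
    unfolding r_def using embedding_two_tops[OF q g f eq] by metis+
  have "r DB s = r DC s" if "s \<noteq> DA (Suc q)" for s
    using that by (auto simp: r_def split: ddiamond.split)
  \<comment> \<open>The climb ends at \<open>q\<close>, one short of the lower tail length
    \<open>Suc q\<close>, so the results are \<open>d_(q+1)^-\<close>-sets.\<close>
  then obtain s s' where s: "embedding P (Suc q) q s" "embedding P (Suc q) q s'"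
    "\<And>x. x \<noteq> DA (Suc q) \<Longrightarrow> s x = s' x"
    "s (DA (Suc q)) = r DB (DA (Suc q))" "s' (DA (Suc q)) = r DC (DA (Suc q))"
    using embedding_pair_climb[OF fin _ r _ q] ax by (metis lessI less_Suc_eq_le)
  have "g DB \<noteq> g DC" using g by (auto simp: embedding_def)
  then have "s (DA (Suc q)) \<noteq> s' (DA (Suc q))" using s by (simp add: r_def)
  moreover have "s ` truncated q q = s' ` truncated q q" by (intro image_cong refl s(3)) auto
  ultimately have "overlapping P (Suc q) (s ` truncated (Suc q) q) (s' ` truncated (Suc q) q)"
    using overlapping_embeddings[OF q s(1,2)] by blast
  then show False using nod by (auto simp: axiom_NODm_def)
qed

text \<open>Removing the top leaves a \<open>d_h^-\<close>-set, and the axiom supplies some element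
  covering exactly its maximal elements. By uniqueness this is the original top.\<close>

lemma embedding_top_covers:
  assumes fin: "locally_finite P" and q: "2 \<le> q"
    and ax: "\<And>j. 3 \<le> j \<Longrightarrow> j \<le> Suc q \<Longrightarrow> axiom_DmCF P j" and nod: "axiom_NODm P (Suc q)"
    and g: "embedding P (Suc q) (Suc q) g"
  shows "{x. covered_by P x (g (DF (Suc q)))} = g ` tops q"
proof -
  have "embedding P (Suc q) q g" using embedding_restrict[OF g] by simp
  then obtain z where z: "embedding P (Suc q) (Suc q) (g(DF (Suc q) := z))"
    and cov: "{x. covered_by P x z} = g ` tops q"
    using embedding_DmCF[OF ax[of "Suc q"] q] q by (metis Suc_le_mono numeral_2_eq_2 numeral_3_eq_3 order_refl)
  have "(g(DF (Suc q) := z)) s = g s" if "s \<in> truncated (Suc q) q" for s using that by auto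
  then have "z = g (DF (Suc q))"
    using embedding_top_unique[OF fin q _ nod g z] ax by auto
  then show ?thesis using cov by simp
qed

text \<open>In the induction step the common top determines the elements it covers, and these are
  the maximal elements of both smaller copies, which agree by induction.\<close>

lemma embedding_same_tops:
  assumes fin: "locally_finite P"
    and q: "2 \<le> q" and ax: "\<And>j. 3 \<le> j \<Longrightarrow> j \<le> Suc q \<Longrightarrow> axiom_DmCF P j \<and> axiom_NODm P j"
    and g: "embedding P (Suc q) q g" and f: "embedding P (Suc q) q f"
    and eq: "g ` tops q = f ` tops q"
  shows "g ` truncated (Suc q) q = f ` truncated (Suc q) q"
  using q ax g f eq
proof (induction q rule: dec_induct)
  case base
  have "truncated 2 2 = tops 2" by (auto simp: truncated_def tops_def)
  then have eq: "g ` truncated 2 2 = f ` truncated 2 2" using base by simp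
  then have "g (DA (Suc 2)) = f (DA (Suc 2))"
    using overlapping_embeddings[OF _ base(2,3)] base(1)[of "Suc 2"] by (auto simp: axiom_NODm_def)
  then show ?case using eq truncated_Suc_bot[of 2 2] by simp
next
  case (step q)
  have sub: "embedding P (Suc q) (Suc q) g" "embedding P (Suc q) (Suc q) f"
    "embedding P (Suc q) q g" "embedding P (Suc q) q f"
    using embedding_restrict[OF step.prems(2)] embedding_restrict[OF step.prems(3)] by auto
  have top: "g (DF (Suc q)) = f (DF (Suc q))" using step by (simp add: tops_def)
  have "{x. covered_by P x (k (DF (Suc q)))} = k ` tops q" if "embedding P (Suc q) (Suc q) k" for k
    using embedding_top_covers[OF fin _ _ _ that] step(1) step.prems(1) by auto
  then have "g ` tops q = f ` tops q" using sub top by metis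
  then have "g ` truncated (Suc q) q = f ` truncated (Suc q) q"
    using step.IH step.prems(1) sub by auto
  then have eq: "g ` truncated (Suc q) (Suc q) = f ` truncated (Suc q) (Suc q)"
    using top step(1) by (simp add: truncated_Suc_top)
  \<comment> \<open>Everything but the bottom agrees by now, and different bottoms would give
    overlapping sets.\<close>
  then have "g (DA (Suc (Suc q))) = f (DA (Suc (Suc q)))"
    using overlapping_embeddings[OF _ step.prems(2,3)] step.prems(1)[of "Suc (Suc q)"] step(1)
    by (auto simp: axiom_NODm_def)
  then show ?case using eq step(1) truncated_Suc_bot[of "Suc q" "Suc q"] by simp
qed

section \<open>Passages between completeness and the axioms\<close>

lemma overlapping_maximal:
  assumes q: "2 \<le> q" and o: "overlapping P (Suc q) S S'"
  shows "S \<noteq> S'" "maximal_elements S = maximal_elements S'"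
proof -
  have d: "d_minus_set P (Suc q) S" "d_minus_set P (Suc q) S'" using o by (auto simp: overlapping_def)
  have "S \<noteq> S' \<and> maximal_elements S = maximal_elements S'"
  proof (cases "q = 2")
    case True
    then obtain w w' x y where ww: "w \<noteq> w'" and S: "S = {w, x, y}" "S' = {w', x, y}"
      and c: "covered_by P w x" "covered_by P w y" "covered_by P w' x" "covered_by P w' y"
      using o by (auto simp: overlapping_def)
    have less: "w < x" "w < y" "w' < x" "w' < y" using c by (auto simp: covered_by_def)
    have xy: "\<not> x < y" "\<not> y < x" using c by (auto simp: covered_by_def)
    have "maximal_elements S = {x, y}" "maximal_elements S' = {x, y}"
      using less xy by (auto simp: maximal_elements_def S)
    moreover have "w' \<notin> S" using ww less xy by (auto simp: S)
    ultimately show ?thesis using S by auto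
  next
    case False
    then obtain w w' z where P: "w \<in> P" "w' \<in> P" "z \<in> P" and ww: "w \<noteq> w'"
      and S: "S = {w..z} \<inter> P" "S' = {w'..z} \<inter> P"
      using o q by (auto simp: overlapping_def)
    \<comment> \<open>Nonemptiness guarantees that each bottom is below \<open>z\<close>, so that
      \<open>z\<close> lies in both intervals.\<close>
    have "R \<noteq> {}" if "d_minus_set P (Suc q) R" for R
      using that d_minus_set_iff[OF q, of P R] mem_truncated(2) by blast
    then have "S \<noteq> {}" "S' \<noteq> {}" using d by blast+
    then have le: "w \<le> z" "w' \<le> z" using S by auto
    then have "maximal_elements S = {z}" "maximal_elements S' = {z}"
      using P by (auto simp: maximal_elements_def S order.strict_iff_order)
    moreover have "S \<noteq> S'" using P ww le unfolding S
      by (metis IntD1 IntI atLeastAtMost_iff order_antisym order_refl)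
    ultimately show ?thesis by simp
  qed
  then show "S \<noteq> S'" "maximal_elements S = maximal_elements S'" by auto
qed

lemma d_interval_extend:
  assumes fin: "locally_finite P" and q: "2 \<le> q" and d: "d_minus_set P (Suc q) S"
    and z: "z \<in> P" "{x. covered_by P x z} = maximal_elements S"
  shows "d_interval P (Suc q) (S \<union> {z})" "is_maximum (S \<union> {z}) z" "z \<notin> S"
proof -
  obtain g where g: "embedding P (Suc q) q g" "S = g ` truncated (Suc q) q"
    using d d_minus_set_iff[OF q] by blast
  let ?g = "g(DF (Suc q) := z)"
  have g': "embedding P (Suc q) (Suc q) ?g"
    using embedding_extend[OF fin g(1) q z(1)] z(2) embedding_maximal[OF g(1) q] g(2) by simp
  have img: "?g ` truncated (Suc q) (Suc q) = S \<union> {z}"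
    by (auto simp: truncated_Suc_top[OF q] image_iff g)
  show I: "d_interval P (Suc q) (S \<union> {z})" unfolding d_interval_iff[OF q] using g' img[symmetric] by blast
  show max: "is_maximum (S \<union> {z}) z" using embedding_maximum[OF g', of z] img q by simp
  show "z \<notin> S" using embedding_interval_singleton(2)[OF q g(1)] I max g(2) by simp
qed

lemma d_minus_set_DmCF:
  assumes "axiom_DmCF P (Suc q)" and q: "2 \<le> q" and "d_minus_set P (Suc q) S"
  obtains z where "z \<in> P" "{x. covered_by P x z} = maximal_elements S"
proof -
  obtain g where g: "embedding P (Suc q) q g" "S = g ` truncated (Suc q) q"
    using assms d_minus_set_iff[OF q] by blast
  then show ?thesis using embedding_DmCF[OF assms(1) q g(1)] embedding_maximal[OF g(1) q] that by metis
qed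

lemma dk_complete_imp_DmCF:
  assumes fin: "locally_finite P" and q: "2 \<le> q" and "dk_complete P (Suc q)"
  shows "axiom_DmCF P (Suc q)"
  unfolding axiom_DmCF_def
proof (intro allI impI)
  fix S assume d: "d_minus_set P (Suc q) S"
  then obtain z where z: "z \<in> P" "{x. covered_by P x z} = maximal_elements S"
    using assms(3) unfolding dk_complete_def by blast
  have "maximal_elements S \<subseteq> S" by (auto simp: maximal_elements_def)
  then show "\<exists>z. d_interval P (Suc q) (S \<union> {z}) \<and> is_maximum (S \<union> {z}) z \<and> (\<forall>x. covered_by P x z \<longrightarrow> x \<in> S)"
    using d_interval_extend[OF fin q d z] z by blast
qed

lemma dk_complete_imp_NODm:
  assumes q: "2 \<le> q" and "dk_complete P (Suc q)"
  shows "axiom_NODm P (Suc q)"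
  unfolding axiom_NODm_def
proof safe
  fix S S' assume o: "overlapping P (Suc q) S S'"
  then have "d_minus_set P (Suc q) S" "d_minus_set P (Suc q) S'" by (auto simp: overlapping_def)
  then show False
    using assms(2) overlapping_maximal[OF q o] unfolding dk_complete_def by (metis mem_Collect_eq)
qed

lemma DmCF_DMD_imp_NODm:
  assumes fin: "locally_finite P" and q: "2 \<le> q"
    and "axiom_DmCF P (Suc q)" and dmd: "axiom_DMD P (Suc q)"
  shows "axiom_NODm P (Suc q)"
  unfolding axiom_NODm_def
proof safe
  fix S S' assume o: "overlapping P (Suc q) S S'"
  then have d: "d_minus_set P (Suc q) S" "d_minus_set P (Suc q) S'" by (auto simp: overlapping_def)
  note om = overlapping_maximal[OF q o]
  obtain z where z: "z \<in> P" "{x. covered_by P x z} = maximal_elements S"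
    using d_minus_set_DmCF[OF assms(3) q d(1)] .
  note ext = d_interval_extend[OF fin q d(1) z] d_interval_extend[OF fin q d(2) z(1) z(2)[unfolded om(2)]]
  \<comment> \<open>Since \<open>z\<close> is in neither set, the two intervals remain distinct
    although they share their maximum.\<close>
  then have "S \<union> {z} \<noteq> S' \<union> {z}" using om(1) by auto
  then show False using dmd ext unfolding axiom_DMD_def by blast
qed

lemma DmCF_imp_DmC: "axiom_DmCF P h \<Longrightarrow> axiom_DmC P h"
  by (auto simp: axiom_DmCF_def axiom_DmC_def)

text \<open>The axiom does not say on which side of \<open>S\<close> the new element lies. If
  \<open>z\<close> is not the maximum, convexity of \<open>S\<close> makes it the minimum of the
  interval. Then it adds nothing above \<open>b\<close>, whereas the upper tail of a
  \<open>d_h\<close>-interval is longer by one than that of a \<open>d_h^-\<close>-set.\<close>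

lemma DmC_maximum:
  assumes q: "2 \<le> q" and d: "d_minus_set P (Suc q) S" and I: "d_interval P (Suc q) (S \<union> {z})"
  shows "is_maximum (S \<union> {z}) z"
proof (rule ccontr)
  assume nmax: "\<not> is_maximum (S \<union> {z}) z"
  let ?T = "truncated (Suc q) (Suc q)"
  obtain g where g: "embedding P (Suc q) q g" "S = g ` truncated (Suc q) q"
    using d d_minus_set_iff[OF q] by blast
  obtain f where f: "embedding P (Suc q) (Suc q) f" "S \<union> {z} = f ` ?T"
    using I d_interval_iff[OF q] by blast
  have cS: "card S = card (truncated (Suc q) q)"
    using g card_image[OF embedding_inj] by blast
  have cT: "card (S \<union> {z}) = card ?T"
    using f card_image[OF embedding_inj] by metis
  have zS: "z \<notin> S"
  proof
    assume "z \<in> S"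
    then have "S \<union> {z} = S" by auto
    then show False using cS cT card_truncated_Suc[OF q, of "Suc q"] by simp
  qed
  have bot: "DA (Suc q) \<in> ?T" and top: "DF (Suc q) \<in> ?T" using q by auto
  have "f (DF (Suc q)) \<in> S \<union> {z}" "f (DF (Suc q)) \<noteq> z"
    using nmax embedding_maximum[OF f(1), of z] f(2) q top by auto
  then have m: "f (DF (Suc q)) \<in> S" by simp
  have "is_maximum (S \<union> {z}) (f (DF (Suc q)))" using embedding_maximum[OF f(1)] f(2) q by simp
  then have zm: "z \<le> f (DF (Suc q))" by (simp add: is_maximum_def)
  obtain r where r: "r \<in> ?T" "z = f r" using f(2) by blast
  have zP: "z \<in> P" using r embedding_subset[OF f(1)] by simp
  have pz: "f (DA (Suc q)) \<le> z" using embedding_minimum[OF f(1) _ r(1)] r(2) q by simp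
  have z: "z = f (DA (Suc q))"
  proof (rule ccontr)
    assume "z \<noteq> f (DA (Suc q))"
    then have "f (DA (Suc q)) \<in> S" using f(2) bot by blast
    moreover have "convex_in P S" using d by (simp add: d_minus_set_def)
    ultimately show False using zS m zm pz zP unfolding convex_in_def by (meson IntI atLeastAtMost_iff subsetD)
  qed
  have "g DB \<in> f ` ?T" "g DC \<in> f ` ?T" using g(2) f(2) by auto
  then obtain x y where xy: "x \<in> ?T" "y \<in> ?T" "g DB = f x" "g DC = f y" by blast
  have "\<not> f x \<le> f y" "\<not> f y \<le> f x" using g(1) xy by (auto simp: embedding_def)
  \<comment> \<open>The image of \<open>b\<close> keeps an incomparable partner in the interval, so
    it must be one of the two middle elements there too.\<close>
  then have x: "x = DB \<or> x = DC"
    using embedding_le_iff[OF f(1) xy(1,2)] embedding_le_iff[OF f(1) xy(2,1)] height_eq[OF xy(1,2)]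
    by (metis linorder_neqE)
  have "{t \<in> S. g DB < t} = g ` DF ` {3..q}"
    using embedding_less_iff[OF g(1), of DB] by (auto simp: g(2) elim!: truncated_cases)
  moreover have "card (g ` DF ` {3..q}) = card {3..q}"
    by (subst card_image, rule inj_on_subset[OF embedding_inj[OF g(1)]]) (auto simp: card_image inj_on_def)
  moreover have "{t \<in> S. g DB < t} = {t \<in> f ` ?T. f x < t}"
    using f(2)[symmetric] xy(3) pz z embedding_minimum[OF f(1) _ xy(1)] q by (auto simp: less_le_not_le)
  moreover have "{t \<in> f ` ?T. f x < t} = f ` DF ` {3..Suc q}"
    using embedding_less_iff[OF f(1) xy(1)] x by (auto elim!: truncated_cases)
  moreover have "card (f ` DF ` {3..Suc q}) = card {3..Suc q}"
    by (subst card_image, rule inj_on_subset[OF embedding_inj[OF f(1)]]) (auto simp: card_image inj_on_def)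
  ultimately have "card {3..q} = card {3..Suc q}" by simp
  then show False using q by simp
qed

lemma DmC_DMF_imp_DmCF:
  assumes q: "2 \<le> q" and "axiom_DmC P (Suc q)" and "axiom_DMF P (Suc q)"
  shows "axiom_DmCF P (Suc q)"
  unfolding axiom_DmCF_def
proof (intro allI impI)
  fix S assume d: "d_minus_set P (Suc q) S"
  then obtain z where z: "d_interval P (Suc q) (S \<union> {z})"
    using assms(2) unfolding axiom_DmC_def by blast
  have max: "is_maximum (S \<union> {z}) z" by (rule DmC_maximum[OF q d z])
  have "x \<in> S" if "covered_by P x z" for x
  proof -
    have "x \<in> S \<union> {z}" using assms(3) z max that unfolding axiom_DMF_def by blast
    then show ?thesis using that by (auto simp: covered_by_def)
  qed
  then show "\<exists>z. d_interval P (Suc q) (S \<union> {z}) \<and> is_maximum (S \<union> {z}) z \<and> (\<forall>x. covered_by P x z \<longrightarrow> x \<in> S)"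
    using z max by blast
qed

text \<open>Both follow from knowing that a maximum covers exactly the coatoms of its interval:
  equal maxima have equal coatoms, and these determine the rest.\<close>

lemma DmCF_NODm_imp_DMF_DMD:
  assumes fin: "locally_finite P" and q: "2 \<le> q"
    and ax: "\<And>j. 3 \<le> j \<Longrightarrow> j \<le> Suc q \<Longrightarrow> axiom_DmCF P j \<and> axiom_NODm P j"
  shows "axiom_DMF P (Suc q)" "axiom_DMD P (Suc q)"
proof -
  let ?T = "truncated (Suc q) (Suc q)"
  have cov: "{x. covered_by P x (g (DF (Suc q)))} = g ` tops q" if "embedding P (Suc q) (Suc q) g" for g
    using embedding_top_covers[OF fin q _ _ that] ax q by auto
  show "axiom_DMF P (Suc q)"
    unfolding axiom_DMF_def
  proof (intro allI impI, elim conjE)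
    fix I m x assume I: "d_interval P (Suc q) I" and m: "is_maximum I m" and x: "covered_by P x m"
    obtain g where g: "embedding P (Suc q) (Suc q) g" "I = g ` ?T" using I d_interval_iff[OF q] by blast
    have "m = g (DF (Suc q))" using embedding_maximum[OF g(1)] m g(2) q by simp
    then have "x \<in> g ` tops q" using cov[OF g(1)] x by blast
    then show "x \<in> I" using embedding_coatoms[OF g(1) q] g(2) by blast
  qed
  show "axiom_DMD P (Suc q)"
    unfolding axiom_DMD_def
  proof (intro allI impI notI, elim conjE)
    fix I J m n assume I: "d_interval P (Suc q) I" "is_maximum I m" and J: "d_interval P (Suc q) J" "is_maximum J n"
      and neq: "I \<noteq> J" and mn: "m = n"
    obtain g where g: "embedding P (Suc q) (Suc q) g" "I = g ` ?T" using I d_interval_iff[OF q] by blast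
    obtain f where f: "embedding P (Suc q) (Suc q) f" "J = f ` ?T" using J d_interval_iff[OF q] by blast
    have top: "g (DF (Suc q)) = f (DF (Suc q))"
      using embedding_maximum[OF g(1)] embedding_maximum[OF f(1)] g f I J mn q by simp
    then have "g ` tops q = f ` tops q" using cov[OF g(1)] cov[OF f(1)] by simp
    then have "g ` truncated (Suc q) q = f ` truncated (Suc q) q"
      using embedding_same_tops[OF fin q ax] embedding_restrict[OF g(1)] embedding_restrict[OF f(1)] by simp
    then show False using neq top g f by (simp add: truncated_Suc_top[OF q])
  qed
qed

lemma DmCF_NODm_imp_dk_complete:
  assumes fin: "locally_finite P" and q: "2 \<le> q"
    and ax: "\<And>j. 3 \<le> j \<Longrightarrow> j \<le> Suc q \<Longrightarrow> axiom_DmCF P j \<and> axiom_NODm P j"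
  shows "dk_complete P (Suc q)"
  unfolding dk_complete_def
proof (intro allI impI)
  fix S assume d: "d_minus_set P (Suc q) S"
  obtain g where g: "embedding P (Suc q) q g" "S = g ` truncated (Suc q) q"
    using d d_minus_set_iff[OF q] by blast
  obtain z where z: "z \<in> P" "{x. covered_by P x z} = maximal_elements S"
    using d_minus_set_DmCF[OF _ q d] ax[of "Suc q"] q by auto
  have "S' = S" if d': "d_minus_set P (Suc q) S'" and c: "\<forall>x\<in>maximal_elements S'. covered_by P x z" for S'
  proof -
    obtain f where f: "embedding P (Suc q) q f" "S' = f ` truncated (Suc q) q"
      using d' d_minus_set_iff[OF q] by blast
    \<comment> \<open>Only an inclusion is given at first; it becomes an equality because both sides
      have as many elements as \<open>tops q\<close>.\<close>
    have sub: "f ` tops q \<subseteq> g ` tops q"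
      using c z embedding_maximal[OF g(1) q] embedding_maximal[OF f(1) q] g(2) f(2) by blast
    have card: "card (k ` tops q) = card (tops q)" if "embedding P (Suc q) q k" for k
      using card_image inj_on_subset[OF embedding_inj[OF that] tops_subset[OF q]] by blast
    have "f ` tops q = g ` tops q"
      using card_subset_eq[OF _ sub] card[OF g(1)] card[OF f(1)] by (simp add: tops_def)
    then show ?thesis using embedding_same_tops[OF fin q ax f(1) g(1)] f(2) g(2) by simp
  qed
  then show "\<exists>z\<in>P. {x. covered_by P x z} = maximal_elements S \<and>
      (\<forall>S'. d_minus_set P (Suc q) S' \<and> S' \<noteq> S \<longrightarrow> \<not> (\<forall>x\<in>maximal_elements S'. covered_by P x z))"
    using z by blast
qed

section \<open>Assembling the equivalences\<close>

lemma d_upto_complete_iff: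
  fixes P :: "'a::order set"
  assumes fin: "locally_finite P"
  shows
    "d_upto_complete P k \<longleftrightarrow> (\<forall>h. 3 \<le> h \<and> h \<le> k \<longrightarrow> axiom_DmC P h \<and> axiom_DMF P h \<and> axiom_NODm P h)" (is "?C \<longleftrightarrow> ?a")
    "d_upto_complete P k \<longleftrightarrow> (\<forall>h. 3 \<le> h \<and> h \<le> k \<longrightarrow> axiom_DmC P h \<and> axiom_DMF P h \<and> axiom_DMD P h)" (is "_ \<longleftrightarrow> ?b")
    "d_upto_complete P k \<longleftrightarrow> (\<forall>h. 3 \<le> h \<and> h \<le> k \<longrightarrow> axiom_DmCF P h \<and> axiom_NODm P h)" (is "_ \<longleftrightarrow> ?c")
    "d_upto_complete P k \<longleftrightarrow> (\<forall>h. 3 \<le> h \<and> h \<le> k \<longrightarrow> axiom_DmCF P h \<and> axiom_DMD P h)" (is "_ \<longleftrightarrow> ?d")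
proof -
  have pred: "\<exists>q. h = Suc q \<and> 2 \<le> q" if "3 \<le> h" for h :: nat
    using that by (intro exI[of _ "h - 1"]) auto
  have C_c: "?C \<Longrightarrow> ?c"
    unfolding d_upto_complete_def
    using dk_complete_imp_DmCF[OF fin] dk_complete_imp_NODm pred by metis
  \<comment> \<open>Statements at the single index \<open>h\<close> draw on (c) at all indices up to
    \<open>h\<close>, because the climb and the induction pass through the smaller ones.\<close>
  have all: "dk_complete P h \<and> axiom_DMF P h \<and> axiom_DMD P h" if c: ?c and h: "3 \<le> h" "h \<le> k" for h
  proof -
    obtain q where q: "h = Suc q" "2 \<le> q" using pred h by blast
    have "axiom_DmCF P j \<and> axiom_NODm P j" if "3 \<le> j" "j \<le> Suc q" for j using c h q that by auto
    then show ?thesis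
      using DmCF_NODm_imp_dk_complete[OF fin q(2)] DmCF_NODm_imp_DMF_DMD[OF fin q(2)] q(1) by blast
  qed
  have c_C: "?c \<Longrightarrow> ?C" and c_d: "?c \<Longrightarrow> ?d" and c_a: "?c \<Longrightarrow> ?a" and c_b: "?c \<Longrightarrow> ?b"
    unfolding d_upto_complete_def using all DmCF_imp_DmC by blast+
  have a_c: "?a \<Longrightarrow> ?c" and b_d: "?b \<Longrightarrow> ?d" using DmC_DMF_imp_DmCF pred by metis+
  have d_c: "?d \<Longrightarrow> ?c" using DmCF_DMD_imp_NODm[OF fin] pred by metis
  show "?C \<longleftrightarrow> ?a" "?C \<longleftrightarrow> ?b" "?C \<longleftrightarrow> ?c" "?C \<longleftrightarrow> ?d"
    using C_c c_C c_d c_a c_b a_c b_d d_c by argo+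
qed

lemma d_complete_iff_upto: "d_complete P \<longleftrightarrow> (\<forall>k. d_upto_complete P k)"
  by (auto simp: d_complete_def d_upto_complete_def)

theorem theorem9p2:
  fixes P :: "'a::order set" and k :: nat
  assumes "3 \<le> k" and "locally_finite P"
  shows
    "(d_upto_complete P k \<longleftrightarrow>
        (\<forall>h. 3 \<le> h \<and> h \<le> k \<longrightarrow> axiom_DmC P h \<and> axiom_DMF P h \<and> axiom_NODm P h)) \<and>
     (d_upto_complete P k \<longleftrightarrow>
        (\<forall>h. 3 \<le> h \<and> h \<le> k \<longrightarrow> axiom_DmC P h \<and> axiom_DMF P h \<and> axiom_DMD P h)) \<and>
     (d_upto_complete P k \<longleftrightarrow>
        (\<forall>h. 3 \<le> h \<and> h \<le> k \<longrightarrow> axiom_DmCF P h \<and> axiom_NODm P h)) \<and>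
     (d_upto_complete P k \<longleftrightarrow>
        (\<forall>h. 3 \<le> h \<and> h \<le> k \<longrightarrow> axiom_DmCF P h \<and> axiom_DMD P h)) \<and>
     (d_complete P \<longleftrightarrow>
        (\<forall>h\<ge>3. axiom_DmC P h \<and> axiom_DMF P h \<and> axiom_NODm P h)) \<and>
     (d_complete P \<longleftrightarrow>
        (\<forall>h\<ge>3. axiom_DmC P h \<and> axiom_DMF P h \<and> axiom_DMD P h)) \<and>
     (d_complete P \<longleftrightarrow>
        (\<forall>h\<ge>3. axiom_DmCF P h \<and> axiom_NODm P h)) \<and>
     (d_complete P \<longleftrightarrow>
        (\<forall>h\<ge>3. axiom_DmCF P h \<and> axiom_DMD P h))"
proof -
  note upto = d_upto_complete_iff[OF assms(2)]
  \<comment> \<open>The finite equivalences hold for every bound, so the unbounded ones follow by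
    quantifying over it.\<close>
  have all: "d_complete P \<longleftrightarrow> (\<forall>h\<ge>3. A h)"
    if "\<And>k. d_upto_complete P k \<longleftrightarrow> (\<forall>h. 3 \<le> h \<and> h \<le> k \<longrightarrow> A h)" for A
    using that by (auto simp: d_complete_iff_upto)
  show ?thesis by (intro conjI upto all)
qed

end
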